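(* Let $j \ge k$ be positive integers. For any non-bipartite digraph $D$ whose longest dipath is of length $2$, we have $\vec{\lambda}_{j,k}(D) = 2j$.
   Context: All digraphs are finite and strongly simple: they have no loops, no multiple edges, and never contain both edges $xy$ and $yx$. In a digraph $D$, $xy\in E(D)$ denotes an edge directed from $x$ to $y$, and then $x$ is adjacent to $y$. A dipath of length $\ell$ is a sequence of $\ell+1$ distinct vertices $v_0,v_1,\dots,v_\ell$ with $v_iv_{i+1}\in E(D)$ for all $0\le i<\ell$. "The longest dipath has length $m$" means that the maximum length of a dipath in $D$ is $m$. The distance $d_D(x,y)$ is the length of a shortest dipath from $x$ to $y$ (if one exists). For positive integers $j\ge k$, an $L(j,k)$-labeling of $D$ is a function $f$ from $V(D)$ to the nonnegative integers such that $|f(x)-f(y)|\ge j$ whenever $xy\in E(D)$ and $|f(x)-f(y)|\ge k$ whenever $d_D(x,y)=2$. The number $\vec{\lambda}_{j,k}(D)$ is the minimum, over all $L(j,k)$-labelings $f$ of $D$, of the span of $f$ (largest label minus smallest label). Equivalently, it is the minimum over all $L(j,k)$-labelings of the maximum label used. A digraph is bipartite if its underlying (undirected) graph is bipartite. *)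

theory Defs
  imports Graph_Theory.Graph_Theory "HOL-Library.Extended_Nat"
begin

locale strongly_simple_digraph = digraph +
  assumes no_antiparallel: "u \<rightarrow>\<^bsub>G\<^esub> v \<Longrightarrow> \<not> v \<rightarrow>\<^bsub>G\<^esub> u"

text \<open>
  A dipath is a \<^const>\<open>vpath\<close>: a nonempty list of distinct vertices, consecutive ones joined by an
  arc; its length is the number of its arcs.
\<close>

definition longest_dipath_length :: "('a, 'b) pre_digraph \<Rightarrow> nat \<Rightarrow> bool" where
  "longest_dipath_length G m \<longleftrightarrow>
     (\<exists>p. vpath p G \<and> vwalk_length p = m) \<and> (\<forall>p. vpath p G \<longrightarrow> vwalk_length p \<le> m)"

text \<open>The distance is \<open>\<infinity>\<close> (the infimum of the empty set) if there is no dipath from \<open>x\<close> to \<open>y\<close>.\<close>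

definition digraph_dist :: "('a, 'b) pre_digraph \<Rightarrow> 'a \<Rightarrow> 'a \<Rightarrow> enat" where
  "digraph_dist G x y = (INF p \<in> {p. vpath p G \<and> hd p = x \<and> last p = y}. enat (vwalk_length p))"

text \<open>The underlying undirected graph is represented by the symmetric digraph \<^const>\<open>mk_symmetric\<close>.\<close>

definition bipartite_digraph :: "('a, 'b) pre_digraph \<Rightarrow> bool" where
  "bipartite_digraph G \<longleftrightarrow>
     (\<exists>U V. pverts (mk_symmetric G) = U \<union> V \<and> U \<inter> V = {} \<and>
            parcs (mk_symmetric G) \<subseteq> U \<times> V \<union> V \<times> U)"

definition L_labeling :: "nat \<Rightarrow> nat \<Rightarrow> ('a, 'b) pre_digraph \<Rightarrow> ('a \<Rightarrow> nat) \<Rightarrow> bool" where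
  "L_labeling j k G f \<longleftrightarrow>
     (\<forall>x \<in> verts G. \<forall>y \<in> verts G.
        (x \<rightarrow>\<^bsub>G\<^esub> y \<longrightarrow> \<bar>int (f x) - int (f y)\<bar> \<ge> int j) \<and>
        (digraph_dist G x y = 2 \<longrightarrow> \<bar>int (f x) - int (f y)\<bar> \<ge> int k))"

definition label_span :: "('a, 'b) pre_digraph \<Rightarrow> ('a \<Rightarrow> nat) \<Rightarrow> nat" where
  "label_span G f = Max (f ` verts G) - Min (f ` verts G)"

definition L_number :: "nat \<Rightarrow> nat \<Rightarrow> ('a, 'b) pre_digraph \<Rightarrow> nat" where
  "L_number j k G = (LEAST s. \<exists>f. L_labeling j k G f \<and> label_span G f = s)"

text \<open>Labelings exist, so the minimum defining \<^const>\<open>L_number\<close> is attained.\<close>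

lemma digraph_dist_self:
  assumes "x \<in> verts G"
  shows "digraph_dist G x x = 0"
proof -
  have "vpath [x] G" using assms by (auto simp: vpath_def vwalk_def)
  then have "digraph_dist G x x \<le> enat (vwalk_length [x])"
    unfolding digraph_dist_def by (intro INF_lower) auto
  then show ?thesis by (simp add: enat_0)
qed

lemma (in loopfree_digraph) L_labeling_exists:
  assumes "finite (verts G)"
  shows "\<exists>f. L_labeling j k G f"
proof -
  obtain g :: "'a \<Rightarrow> nat" where g: "inj_on g (verts G)"
    using finite_imp_inj_to_nat_seg[OF assms] by blast
  define f where "f x = (j + k) * g x" for x
  have sep: "int (j + k) \<le> \<bar>int (f x) - int (f y)\<bar>"
    if "x \<in> verts G" "y \<in> verts G" "x \<noteq> y" for x y
  proof -
    have "g x \<noteq> g y" using g that by (auto dest: inj_onD)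
    then have "1 \<le> \<bar>int (g x) - int (g y)\<bar>" by linarith
    then have "int (j + k) * 1 \<le> int (j + k) * \<bar>int (g x) - int (g y)\<bar>"
      by (intro mult_left_mono) auto
    also have "\<dots> = \<bar>int (j + k) * (int (g x) - int (g y))\<bar>"
      by (simp add: abs_mult)
    also have "int (j + k) * (int (g x) - int (g y)) = int (f x) - int (f y)"
      by (simp add: f_def algebra_simps)
    finally show ?thesis by simp
  qed
  have "L_labeling j k G f"
    unfolding L_labeling_def
  proof (intro ballI conjI impI)
    fix x y assume xy: "x \<in> verts G" "y \<in> verts G"
    show "int j \<le> \<bar>int (f x) - int (f y)\<bar>" if "x \<rightarrow>\<^bsub>G\<^esub> y"
    proof -
      have "x \<noteq> y" using that no_loops by (auto simp: arcs_ends_conv)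
      then show ?thesis using sep[OF xy] by simp
    qed
    show "int k \<le> \<bar>int (f x) - int (f y)\<bar>" if "digraph_dist G x y = 2"
    proof -
      have "x \<noteq> y" using that digraph_dist_self[OF xy(1)] by auto
      then show ?thesis using sep[OF xy] by simp
    qed
  qed
  then show ?thesis by blast
qed

lemma (in digraph) L_number_attained:
  "\<exists>f. L_labeling j k G f \<and> label_span G f = L_number j k G"
  unfolding L_number_def
proof (rule LeastI_ex)
  show "\<exists>s f. L_labeling j k G f \<and> label_span G f = s"
    using L_labeling_exists[of j k] by simp
qed

end

theory Submission
  imports Defs
begin

text \<open>
  The lower bound needs only the arc condition: if some labeling had span below \<open>2 * j\<close>, then the
  labels in the lower \<open>j\<close> values and those in the upper \<open>j\<close> values would split the vertices into two
  classes, and two labels in the same class differ by less than \<open>j\<close>. No arc would then lie inside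
  a class, so the digraph would be bipartite (\<open>bipartite_if_small_span\<close>).

  For the upper bound it suffices to colour the vertices with \<open>0\<close>, \<open>1\<close>, \<open>2\<close> so that adjacent vertices
  and vertices at distance \<open>2\<close> get different colours; multiplying such a colouring by \<open>j\<close> gives a
  labeling, because \<open>k \<le> j\<close>. In the absence of dipaths of length \<open>3\<close>, three consecutive
  arcs can only run around a directed triangle (\<open>three_arcs_close\<close>). Hence a directed triangle has
  no other neighbours and may be coloured bijectively, whatever happens elsewhere. An arc
  outside the triangles cannot join two vertices that both have in-arcs and out-arcs, so there
  sources, vertices with in-arcs and out-arcs, and sinks can be coloured \<open>0\<close>, \<open>1\<close> and \<open>2\<close>. A walk
  of two arcs that does not lie on a triangle starts in a source and ends in a sink.
\<close>

section \<open>The lower bound\<close>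

lemma bipartite_if_small_span:
  assumes "digraph D" and "L_labeling j k D f" and "label_span D f < 2 * j"
  shows "bipartite_digraph D"
proof -
  interpret digraph D by fact
  define m where "m = Min (f ` verts D)"
  let ?U = "{v \<in> verts D. f v < m + j}" and ?V = "{v \<in> verts D. m + j \<le> f v}"
  have range: "m \<le> f v \<and> f v < m + 2 * j" if "v \<in> verts D" for v
  proof -
    have "m \<le> f v" and "f v \<le> Max (f ` verts D)"
      using that by (auto simp: m_def)
    then show ?thesis
      using assms(3) unfolding label_span_def m_def by linarith
  qed
  have sep: "(x, y) \<in> ?U \<times> ?V \<union> ?V \<times> ?U" if "x \<rightarrow>\<^bsub>D\<^esub> y" for x y
  proof -
    have verts: "x \<in> verts D" "y \<in> verts D"
      using that adj_in_verts by auto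
    then have "int j \<le> \<bar>int (f x) - int (f y)\<bar>"
      using assms(2) that by (auto simp: L_labeling_def)
    then show ?thesis
      using range[OF verts(1)] range[OF verts(2)] verts by auto
  qed
  have "parcs (mk_symmetric D) \<subseteq> ?U \<times> ?V \<union> ?V \<times> ?U"
  proof
    fix a assume "a \<in> parcs (mk_symmetric D)"
    then obtain x y where "x \<rightarrow>\<^bsub>D\<^esub> y" and "a = (x, y) \<or> a = (y, x)"
      unfolding parcs_mk_symmetric using in_arcs_imp_in_arcs_ends by blast
    then show "a \<in> ?U \<times> ?V \<union> ?V \<times> ?U"
      using sep[of x y] by blast
  qed
  moreover have "pverts (mk_symmetric D) = ?U \<union> ?V" and "?U \<inter> ?V = {}"
    by auto
  ultimately show ?thesis
    unfolding bipartite_digraph_def by blast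
qed

section \<open>Three colours without dipaths of length three\<close>

lemma digraph_dist_eq_2D:
  assumes "digraph_dist G x z = 2"
  obtains y where "x \<rightarrow>\<^bsub>G\<^esub> y" and "y \<rightarrow>\<^bsub>G\<^esub> z"
proof -
  let ?P = "{p. vpath p G \<and> hd p = x \<and> last p = z}"
  let ?A = "(\<lambda>p. enat (vwalk_length p)) ` ?P"
  have inf: "Inf ?A = 2"
    using assms by (simp only: digraph_dist_def)
  then have "?A \<noteq> {}"
    unfolding Inf_enat_def by (metis numeral_ne_infinity)
  then have "Inf ?A \<in> ?A"
    unfolding Inf_enat_def using LeastI_ex[of "\<lambda>n. n \<in> ?A"] by auto
  then obtain p where p: "vpath p G" "hd p = x" "last p = z" "enat (vwalk_length p) = 2"
    unfolding inf by auto
  then have "length p = 3"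
    by (auto simp: numeral_eq_enat)
  then obtain a b c where "p = [a, b, c]"
    by (auto simp: numeral_eq_Suc length_Suc_conv)
  with p that show ?thesis
    by (auto simp: vpath_def vwalk_def)
qed

locale no_dipath_of_length_3 = strongly_simple_digraph +
  assumes path_length_le_2: "vpath p G \<Longrightarrow> vwalk_length p \<le> 2"
begin

lemma adj_distinct:
  assumes "x \<rightarrow> y"
  shows "x \<noteq> y"
  using assms no_antiparallel by blast

lemma three_arcs_close:
  assumes "w \<rightarrow> x" and "x \<rightarrow> y" and "y \<rightarrow> z"
  shows "w = z"
proof (rule ccontr)
  assume "w \<noteq> z"
  then have "distinct [w, x, y, z]"
    using assms adj_distinct no_antiparallel by auto
  then have "vpath [w, x, y, z] G"
    using assms adj_in_verts by (auto simp: vpath_def vwalk_def)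
  then have "vwalk_length [w, x, y, z] \<le> 2"
    by (rule path_length_le_2)
  then show False
    by simp
qed

definition neighbourhood :: "'a \<Rightarrow> 'a set" where
  "neighbourhood v = {w. w = v \<or> v \<rightarrow> w \<or> w \<rightarrow> v}"

text \<open>
  An arc that joins a directed triangle to a further vertex would extend the path around the
  triangle to a dipath of length \<open>3\<close>. So all three vertices have the same neighbourhood.
\<close>

lemma neighbourhood_triangle:
  assumes "w \<rightarrow> x" and "x \<rightarrow> y" and "y \<rightarrow> w"
  shows "neighbourhood x = {w, x, y}"
  using assms three_arcs_close unfolding neighbourhood_def by blast

definition on_triangle :: "'a \<Rightarrow> bool" where
  "on_triangle v \<longleftrightarrow> (\<exists>u w. u \<rightarrow> v \<and> v \<rightarrow> w \<and> w \<rightarrow> u)"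

text \<open>
  The choice depends only on the neighbourhood, so the three vertices of a directed triangle agree
  on which of them is the root.
\<close>

definition root :: "'a \<Rightarrow> 'a" where
  "root v = (SOME r. r \<in> neighbourhood v)"

definition colour :: "'a \<Rightarrow> nat" where
  "colour v =
     (if on_triangle v then (if v = root v then 0 else if root v \<rightarrow> v then 1 else 2)
      else if \<nexists>u. u \<rightarrow> v then 0
      else if \<nexists>u. v \<rightarrow> u then 2
      else 1)"

lemma colour_le_2: "colour v \<le> 2"
  by (simp add: colour_def)

lemma colour_triangle:
  assumes "w \<rightarrow> x" and "x \<rightarrow> y" and "y \<rightarrow> w"
  shows "colour x \<noteq> colour y"
proof -
  have "neighbourhood x = {w, x, y}" and "neighbourhood y = {w, x, y}"
    using neighbourhood_triangle[of w x y] neighbourhood_triangle[of x y w] assms by auto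
  then have "root y = root x" and "root x \<in> {w, x, y}"
    unfolding root_def by (simp, metis insertI1 someI_ex)
  moreover have "on_triangle x" and "on_triangle y"
    using assms unfolding on_triangle_def by blast+
  ultimately show ?thesis
    using assms no_antiparallel adj_distinct unfolding colour_def by auto
qed

text \<open>
  If the tail has an in-arc and the head has an out-arc, then the arc is the middle one of three
  consecutive arcs, hence it lies on a triangle. Otherwise the tail is a source or the head a sink.
\<close>

lemma colour_adj:
  assumes "x \<rightarrow> y"
  shows "colour x \<noteq> colour y"
proof (cases "\<exists>w z. w \<rightarrow> x \<and> y \<rightarrow> z")
  case True
  then obtain w where "w \<rightarrow> x" "y \<rightarrow> w"
    using assms three_arcs_close by blast
  then show ?thesis
    using assms colour_triangle by blast
next
  case False
  then have "\<not> on_triangle x" and "\<not> on_triangle y"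
    using assms three_arcs_close unfolding on_triangle_def by blast+
  then show ?thesis
    using False assms unfolding colour_def by auto
qed

text \<open>
  Unless \<open>x\<close>, \<open>y\<close>, \<open>z\<close> form a directed triangle, any arc into \<open>x\<close> or out of \<open>z\<close> would produce three
  consecutive arcs that do not close up. So \<open>x\<close> is a source and \<open>z\<close> is a sink.
\<close>

lemma colour_two_arcs:
  assumes "x \<rightarrow> y" and "y \<rightarrow> z"
  shows "colour x \<noteq> colour z"
proof (cases "z \<rightarrow> x")
  case True
  then show ?thesis
    using colour_adj by force
next
  case False
  then have "\<nexists>u. u \<rightarrow> x" and "\<nexists>u. z \<rightarrow> u"
    using assms three_arcs_close by blast+
  then show ?thesis
    using assms unfolding colour_def on_triangle_def by auto
qed

lemma L_labeling_colour:
  assumes "k \<le> j"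
  shows "L_labeling j k G (\<lambda>v. j * colour v)"
proof -
  have sep: "int j \<le> \<bar>int (j * colour x) - int (j * colour y)\<bar>" if "colour x \<noteq> colour y" for x y
  proof -
    have "int j * 1 \<le> int j * \<bar>int (colour x) - int (colour y)\<bar>"
      using that by (intro mult_left_mono) auto
    then show ?thesis
      by (simp add: abs_mult flip: right_diff_distrib)
  qed
  show ?thesis
    unfolding L_labeling_def
  proof (intro ballI conjI impI)
    fix x z
    show "int j \<le> \<bar>int (j * colour x) - int (j * colour z)\<bar>" if "x \<rightarrow> z"
      using sep colour_adj that by blast
    assume "digraph_dist G x z = 2"
    then have "colour x \<noteq> colour z"
      using colour_two_arcs by (blast elim: digraph_dist_eq_2D)
    from sep[OF this] show "int k \<le> \<bar>int (j * colour x) - int (j * colour z)\<bar>"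
      using assms by linarith
  qed
qed

lemma label_span_colour:
  assumes "verts G \<noteq> {}"
  shows "label_span G (\<lambda>v. j * colour v) \<le> 2 * j"
proof -
  have "Max ((\<lambda>v. j * colour v) ` verts G) \<le> 2 * j"
    using assms colour_le_2 by (auto simp: mult.commute)
  then show ?thesis
    unfolding label_span_def by linarith
qed

end

section \<open>The value of the labeling number\<close>

theorem theorem6:
  fixes D :: "('a, 'b) pre_digraph" and j k :: nat
  assumes "0 < k" and "k \<le> j"
    and "strongly_simple_digraph D"
    and "\<not> bipartite_digraph D"
    and "longest_dipath_length D 2"
  shows "L_number j k D = 2 * j"
proof (rule antisym)
  interpret strongly_simple_digraph D by fact
  interpret no_dipath_of_length_3 D
    using assms(5) by unfold_locales (auto simp: longest_dipath_length_def)
  have "verts D \<noteq> {}"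
    using assms(5) by (auto simp: longest_dipath_length_def vpath_def vwalk_def)
  moreover have "L_number j k D \<le> label_span D (\<lambda>v. j * colour v)"
    unfolding L_number_def using L_labeling_colour[OF assms(2)] by (intro Least_le) blast
  ultimately show "L_number j k D \<le> 2 * j"
    using label_span_colour order_trans by blast
  obtain f where "L_labeling j k D f" and "label_span D f = L_number j k D"
    using L_number_attained by blast
  then show "2 * j \<le> L_number j k D"
    using bipartite_if_small_span[OF digraph_axioms] assms(4) by (metis not_le)
qed

end
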